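(* Let $\mathcal{D}$ be an extriangulated category with negative first extension and let $(\mathcal{T},\mathcal{F})$ be an $s$-torsion pair in $\mathcal{D}$. Then the following statements hold. (a) $\mathcal{T}$ is closed under cones, extensions and direct summands. (b) $\mathcal{F}$ is closed under cocones, extensions and direct summands. (c) Let $X\to Y\to Z$ be an $\mathfrak{s}$-conflation in $\mathcal{D}$. Then: (c1) $X\in{}^{\perp_{-1}}\mathcal{F}$ if $Y,Z\in\mathcal{T}$; (c2) $Z\in\mathcal{T}^{\perp_{-1}}$ if $X,Y\in\mathcal{F}$. (d) For any $s$-torsion pair $(\mathcal{X},\mathcal{Y})$ in $\mathcal{D}$, $\mathcal{X}\subseteq\mathcal{T}$ if and only if $\mathcal{F}\subseteq\mathcal{Y}$.
   Context: Extriangulated categories $(\mathcal{D},\mathbb{E},\mathfrak{s})$ are in the sense of Nakaoka–Palu; an $\mathfrak{s}$-conflation (= $\mathbb{E}$-triangle) is a sequence $A\to B\to C$ realizing an element of $\mathbb{E}(C,A)$. $\mathcal{D}$ has negative first extension if there are an additive bifunctor $\mathbb{E}^{-1}:\mathcal{D}^{op}\times\mathcal{D}\to\mathrm{Ab}$ and, for each $\delta\in\mathbb{E}(C,A)$, natural transformations $\delta^{-1}:\mathbb{E}^{-1}(-,C)\to\mathcal{D}(-,A)$ and $\delta_{-1}:\mathbb{E}^{-1}(A,-)\to\mathcal{D}(C,-)$ such that, for each $\mathfrak{s}$-conflation $A\to B\to C$ realizing $\delta$ and each $W\in\mathcal{D}$, the sequences $\mathbb{E}^{-1}(W,A)\to\mathbb{E}^{-1}(W,B)\to\mathbb{E}^{-1}(W,C)\xrightarrow{\delta^{-1}}\mathcal{D}(W,A)\to\mathcal{D}(W,B)$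 and $\mathbb{E}^{-1}(C,W)\to\mathbb{E}^{-1}(B,W)\to\mathbb{E}^{-1}(A,W)\xrightarrow{\delta_{-1}}\mathcal{D}(C,W)\to\mathcal{D}(B,W)$ are exact. An $s$-torsion pair in $\mathcal{D}$ is a pair $(\mathcal{T},\mathcal{F})$ of full isomorphism-closed subcategories with $\mathcal{D}(\mathcal{T},\mathcal{F})=0$, $\mathbb{E}^{-1}(\mathcal{T},\mathcal{F})=0$, and such that every $D\in\mathcal{D}$ admits an $\mathfrak{s}$-conflation $T\to D\to F$ with $T\in\mathcal{T}$, $F\in\mathcal{F}$. A class $\mathcal{Z}\subseteq\mathcal{D}$ is closed under extensions (resp. cones, cocones) if for each $\mathfrak{s}$-conflation $A\to B\to C$ with $A,C\in\mathcal{Z}$ (resp. $A,B\in\mathcal{Z}$; $B,C\in\mathcal{Z}$) one has $B\in\mathcal{Z}$ (resp. $C\in\mathcal{Z}$; $A\in\mathcal{Z}$). $\mathcal{X}^{\perp_{-1}}=\{D\in\mathcal{D}:\mathbb{E}^{-1}(X,D)=0\ \forall X\in\mathcal{X}\}$ and ${}^{\perp_{-1}}\mathcal{X}=\{D\in\mathcal{D}:\mathbb{E}^{-1}(D,X)=0\ \forall X\in\mathcal{X}\}$. *)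

theory Defs
  imports "HOL-Algebra.Elementary_Groups"
begin

text \<open>
  Extriangulated categories in the sense of Nakaoka and Palu, negative first extensions,
  and s-torsion pairs.

  Abelian groups are commutative groups in the sense of HOL-Algebra.  They are therefore written
  multiplicatively: \<open>\<otimes>\<close> is the sum and \<open>\<one>\<close> is the zero element
  (so \<open>\<one>\<^bsub>Mor D A B\<^esub>\<close> is the zero morphism, whereas \<open>idm D A\<close> is the identity).
\<close>


section \<open>Additive categories\<close>

record ('o, 'm) cat =
  obj :: "'o set"
  Mor :: "'o \<Rightarrow> 'o \<Rightarrow> 'm monoid"
  cmp :: "'m \<Rightarrow> 'm \<Rightarrow> 'm"  (infixl "\<cdot>\<index>" 75)
  idm :: "'o \<Rightarrow> 'm"

abbreviation arr :: "('o, 'm, 'z) cat_scheme \<Rightarrow> 'o \<Rightarrow> 'o \<Rightarrow> 'm set"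
  where "arr D A B \<equiv> carrier (Mor D A B)"

text \<open>
  Hom-sets are required to be disjoint, so that a morphism determines its domain and codomain;
  this is why the action of a bifunctor on morphisms below needs no object arguments.
\<close>

locale preadditive_category =
  fixes D :: "('o, 'm, 'z) cat_scheme" (structure)
  assumes hom_group: "\<lbrakk>A \<in> obj D; B \<in> obj D\<rbrakk> \<Longrightarrow> comm_group (Mor D A B)"
    and hom_disjoint:
      "\<lbrakk>A \<in> obj D; B \<in> obj D; A' \<in> obj D; B' \<in> obj D; f \<in> arr D A B; f \<in> arr D A' B'\<rbrakk>
        \<Longrightarrow> A = A' \<and> B = B'"
    and idm_closed: "A \<in> obj D \<Longrightarrow> idm D A \<in> arr D A A"
    and cmp_closed:
      "\<lbrakk>A \<in> obj D; B \<in> obj D; C \<in> obj D; f \<in> arr D A B; g \<in> arr D B C\<rbrakk> \<Longrightarrow> g \<cdot> f \<in> arr D A C"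
    and idm_left: "\<lbrakk>A \<in> obj D; B \<in> obj D; f \<in> arr D A B\<rbrakk> \<Longrightarrow> idm D B \<cdot> f = f"
    and idm_right: "\<lbrakk>A \<in> obj D; B \<in> obj D; f \<in> arr D A B\<rbrakk> \<Longrightarrow> f \<cdot> idm D A = f"
    and cmp_assoc:
      "\<lbrakk>A \<in> obj D; B \<in> obj D; C \<in> obj D; X \<in> obj D;
        f \<in> arr D A B; g \<in> arr D B C; h \<in> arr D C X\<rbrakk> \<Longrightarrow> h \<cdot> (g \<cdot> f) = (h \<cdot> g) \<cdot> f"
    and cmp_add_left:
      "\<lbrakk>A \<in> obj D; B \<in> obj D; C \<in> obj D; f \<in> arr D A B; g \<in> arr D B C; g' \<in> arr D B C\<rbrakk>
        \<Longrightarrow> (g \<otimes>\<^bsub>Mor D B C\<^esub> g') \<cdot> f = (g \<cdot> f) \<otimes>\<^bsub>Mor D A C\<^esub> (g' \<cdot> f)"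
    and cmp_add_right:
      "\<lbrakk>A \<in> obj D; B \<in> obj D; C \<in> obj D; f \<in> arr D A B; f' \<in> arr D A B; g \<in> arr D B C\<rbrakk>
        \<Longrightarrow> g \<cdot> (f \<otimes>\<^bsub>Mor D A B\<^esub> f') = (g \<cdot> f) \<otimes>\<^bsub>Mor D A C\<^esub> (g \<cdot> f')"

definition is_zero_object :: "('o, 'm, 'z) cat_scheme \<Rightarrow> 'o \<Rightarrow> bool"
  where "is_zero_object D Z \<longleftrightarrow>
    Z \<in> obj D \<and> (\<forall>A\<in>obj D. (\<exists>!f. f \<in> arr D A Z) \<and> (\<exists>!f. f \<in> arr D Z A))"

definition is_biproduct ::
    "('o, 'm, 'z) cat_scheme \<Rightarrow> 'o \<Rightarrow> 'o \<Rightarrow> 'o \<Rightarrow> 'm \<Rightarrow> 'm \<Rightarrow> 'm \<Rightarrow> 'm \<Rightarrow> bool"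
  where "is_biproduct D A B S i\<^sub>A i\<^sub>B p\<^sub>A p\<^sub>B \<longleftrightarrow>
    A \<in> obj D \<and> B \<in> obj D \<and> S \<in> obj D \<and>
    i\<^sub>A \<in> arr D A S \<and> i\<^sub>B \<in> arr D B S \<and> p\<^sub>A \<in> arr D S A \<and> p\<^sub>B \<in> arr D S B \<and>
    p\<^sub>A \<cdot>\<^bsub>D\<^esub> i\<^sub>A = idm D A \<and> p\<^sub>B \<cdot>\<^bsub>D\<^esub> i\<^sub>B = idm D B \<and>
    p\<^sub>A \<cdot>\<^bsub>D\<^esub> i\<^sub>B = \<one>\<^bsub>Mor D B A\<^esub> \<and> p\<^sub>B \<cdot>\<^bsub>D\<^esub> i\<^sub>A = \<one>\<^bsub>Mor D A B\<^esub> \<and>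
    (i\<^sub>A \<cdot>\<^bsub>D\<^esub> p\<^sub>A) \<otimes>\<^bsub>Mor D S S\<^esub> (i\<^sub>B \<cdot>\<^bsub>D\<^esub> p\<^sub>B) = idm D S"

definition is_iso :: "('o, 'm, 'z) cat_scheme \<Rightarrow> 'o \<Rightarrow> 'o \<Rightarrow> 'm \<Rightarrow> bool"
  where "is_iso D A B f \<longleftrightarrow>
    f \<in> arr D A B \<and> (\<exists>g\<in>arr D B A. g \<cdot>\<^bsub>D\<^esub> f = idm D A \<and> f \<cdot>\<^bsub>D\<^esub> g = idm D B)"

locale additive_category = preadditive_category D for D :: "('o, 'm, 'z) cat_scheme" (structure) +
  assumes has_zero_object: "\<exists>Z. is_zero_object D Z"
    and has_biproducts:
      "\<lbrakk>A \<in> obj D; B \<in> obj D\<rbrakk> \<Longrightarrow> \<exists>S i\<^sub>A i\<^sub>B p\<^sub>A p\<^sub>B. is_biproduct D A B S i\<^sub>A i\<^sub>B p\<^sub>A p\<^sub>B"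


section \<open>Additive bifunctors to abelian groups\<close>

text \<open>
  A bifunctor \<open>G\<close> on \<open>D\<^sup>o\<^sup>p \<times> D\<close>: the first argument is the contravariant one.
  For \<open>c : C' \<rightarrow> C\<close> and \<open>a : A \<rightarrow> A'\<close>, the map \<open>Gm c a : G C A \<rightarrow> G C' A'\<close> is \<open>G(c, a)\<close>.
\<close>

locale additive_bifunctor = preadditive_category D for D :: "('o, 'm, 'z) cat_scheme" (structure) +
  fixes G :: "'o \<Rightarrow> 'o \<Rightarrow> 'e monoid" and Gm :: "'m \<Rightarrow> 'm \<Rightarrow> 'e \<Rightarrow> 'e"
  assumes bif_group: "\<lbrakk>C \<in> obj D; A \<in> obj D\<rbrakk> \<Longrightarrow> comm_group (G C A)"
    and bif_hom:
      "\<lbrakk>C \<in> obj D; C' \<in> obj D; A \<in> obj D; A' \<in> obj D; c \<in> arr D C' C; a \<in> arr D A A'\<rbrakk>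
        \<Longrightarrow> Gm c a \<in> hom (G C A) (G C' A')"
    and bif_id:
      "\<lbrakk>C \<in> obj D; A \<in> obj D; e \<in> carrier (G C A)\<rbrakk> \<Longrightarrow> Gm (idm D C) (idm D A) e = e"
    and bif_cmp:
      "\<lbrakk>C \<in> obj D; C' \<in> obj D; C'' \<in> obj D; A \<in> obj D; A' \<in> obj D; A'' \<in> obj D;
        c \<in> arr D C' C; c' \<in> arr D C'' C'; a \<in> arr D A A'; a' \<in> arr D A' A''; e \<in> carrier (G C A)\<rbrakk>
        \<Longrightarrow> Gm (c \<cdot> c') (a' \<cdot> a) e = Gm c' a' (Gm c a e)"
    and bif_add_left:
      "\<lbrakk>C \<in> obj D; C' \<in> obj D; A \<in> obj D; A' \<in> obj D;
        c \<in> arr D C' C; c' \<in> arr D C' C; a \<in> arr D A A'; e \<in> carrier (G C A)\<rbrakk>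
        \<Longrightarrow> Gm (c \<otimes>\<^bsub>Mor D C' C\<^esub> c') a e = Gm c a e \<otimes>\<^bsub>G C' A'\<^esub> Gm c' a e"
    and bif_add_right:
      "\<lbrakk>C \<in> obj D; C' \<in> obj D; A \<in> obj D; A' \<in> obj D;
        c \<in> arr D C' C; a \<in> arr D A A'; a' \<in> arr D A A'; e \<in> carrier (G C A)\<rbrakk>
        \<Longrightarrow> Gm c (a \<otimes>\<^bsub>Mor D A A'\<^esub> a') e = Gm c a e \<otimes>\<^bsub>G C' A'\<^esub> Gm c a' e"


section \<open>Extriangulated categories\<close>

text \<open>
  \<open>Ext D C A\<close> is the group of extensions written \<open>E(C, A)\<close>; \<open>realisation D C A \<delta>\<close> is the equivalence
  class \<open>s(\<delta>)\<close>.  A sequence \<open>A \<rightarrow> B \<rightarrow> C\<close> with morphisms \<open>x\<close> and \<open>y\<close> is encoded as \<open>(x, B, y)\<close>.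
\<close>

record ('o, 'm, 'e) extri = "('o, 'm) cat" +
  Ext :: "'o \<Rightarrow> 'o \<Rightarrow> 'e monoid"
  ext_map :: "'m \<Rightarrow> 'm \<Rightarrow> 'e \<Rightarrow> 'e"
  realisation :: "'o \<Rightarrow> 'o \<Rightarrow> 'e \<Rightarrow> ('m \<times> 'o \<times> 'm) set"

text \<open>The extensions \<open>a\<^sub>*\<delta>\<close>, for \<open>\<delta>\<close> over \<open>C\<close>, and \<open>c\<^sup>*\<delta>\<close>, for \<open>\<delta>\<close> under \<open>A\<close>.\<close>

abbreviation push :: "('o, 'm, 'e, 'z) extri_scheme \<Rightarrow> 'o \<Rightarrow> 'm \<Rightarrow> 'e \<Rightarrow> 'e"
  where "push D C a \<delta> \<equiv> ext_map D (idm D C) a \<delta>"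

abbreviation pull :: "('o, 'm, 'e, 'z) extri_scheme \<Rightarrow> 'o \<Rightarrow> 'm \<Rightarrow> 'e \<Rightarrow> 'e"
  where "pull D A c \<delta> \<equiv> ext_map D c (idm D A) \<delta>"

definition ext_morphism ::
    "('o, 'm, 'e, 'z) extri_scheme \<Rightarrow> 'o \<Rightarrow> 'e \<Rightarrow> 'o \<Rightarrow> 'o \<Rightarrow> 'e \<Rightarrow> 'o \<Rightarrow> 'm \<Rightarrow> 'm \<Rightarrow> bool"
  where "ext_morphism D A \<delta> C A' \<delta>' C' a c \<longleftrightarrow>
    a \<in> arr D A A' \<and> c \<in> arr D C C' \<and> push D C a \<delta> = pull D A' c \<delta>'"

definition sequences :: "('o, 'm, 'z) cat_scheme \<Rightarrow> 'o \<Rightarrow> 'o \<Rightarrow> ('m \<times> 'o \<times> 'm) set"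
  where "sequences D A C = {(x, B, y). B \<in> obj D \<and> x \<in> arr D A B \<and> y \<in> arr D B C}"

definition seq_equiv ::
    "('o, 'm, 'z) cat_scheme \<Rightarrow> 'o \<Rightarrow> 'o \<Rightarrow> (('m \<times> 'o \<times> 'm) \<times> ('m \<times> 'o \<times> 'm)) set"
  where "seq_equiv D A C =
    {((x, B, y), (x', B', y')).
       (x, B, y) \<in> sequences D A C \<and> (x', B', y') \<in> sequences D A C \<and>
       (\<exists>b. is_iso D B B' b \<and> b \<cdot>\<^bsub>D\<^esub> x = x' \<and> y' \<cdot>\<^bsub>D\<^esub> b = y)}"

definition realizes ::
    "('o, 'm, 'e, 'z) extri_scheme \<Rightarrow> 'o \<Rightarrow> 'm \<Rightarrow> 'o \<Rightarrow> 'm \<Rightarrow> 'o \<Rightarrow> 'e \<Rightarrow> bool"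
  where "realizes D A x B y C \<delta> \<longleftrightarrow>
    A \<in> obj D \<and> C \<in> obj D \<and> \<delta> \<in> carrier (Ext D C A) \<and>
    (x, B, y) \<in> sequences D A C \<and> (x, B, y) \<in> realisation D C A \<delta>"

definition conflation :: "('o, 'm, 'e, 'z) extri_scheme \<Rightarrow> 'o \<Rightarrow> 'm \<Rightarrow> 'o \<Rightarrow> 'm \<Rightarrow> 'o \<Rightarrow> bool"
  where "conflation D A x B y C \<longleftrightarrow> (\<exists>\<delta>. realizes D A x B y C \<delta>)"

text \<open>
  The components of \<open>\<epsilon> \<in> E(C \<oplus> C', A \<oplus> A')\<close> in \<open>E(C, A)\<close>, \<open>E(C, A')\<close>, \<open>E(C', A)\<close> and \<open>E(C', A')\<close> are
  \<open>\<delta>\<close>, 0, 0 and \<open>\<delta>'\<close>, that is, \<open>\<epsilon> = \<delta> \<oplus> \<delta>'\<close>.  Only the injections of \<open>C \<oplus> C'\<close> and the projections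
  of \<open>A \<oplus> A'\<close> enter.
\<close>

definition is_ext_sum ::
    "('o, 'm, 'e, 'z) extri_scheme \<Rightarrow> 'o \<Rightarrow> 'e \<Rightarrow> 'o \<Rightarrow> 'o \<Rightarrow> 'e \<Rightarrow> 'o
      \<Rightarrow> 'o \<Rightarrow> 'm \<Rightarrow> 'm \<Rightarrow> 'o \<Rightarrow> 'm \<Rightarrow> 'm \<Rightarrow> 'e \<Rightarrow> bool"
  where "is_ext_sum D A \<delta> C A' \<delta>' C' SA p\<^sub>A p\<^sub>A' SC i\<^sub>C i\<^sub>C' \<epsilon> \<longleftrightarrow>
    \<epsilon> \<in> carrier (Ext D SC SA) \<and>
    ext_map D i\<^sub>C p\<^sub>A \<epsilon> = \<delta> \<and> ext_map D i\<^sub>C p\<^sub>A' \<epsilon> = \<one>\<^bsub>Ext D C A'\<^esub> \<and>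
    ext_map D i\<^sub>C' p\<^sub>A \<epsilon> = \<one>\<^bsub>Ext D C' A\<^esub> \<and> ext_map D i\<^sub>C' p\<^sub>A' \<epsilon> = \<delta>'"

locale extriangulated_category =
    additive_category D + E: additive_bifunctor D "Ext D" "ext_map D"
    for D :: "('o, 'm, 'e, 'z) extri_scheme" (structure) +
  assumes realisation_class:
      "\<lbrakk>A \<in> obj D; C \<in> obj D; \<delta> \<in> carrier (Ext D C A)\<rbrakk>
        \<Longrightarrow> realisation D C A \<delta> \<in> sequences D A C // seq_equiv D A C"
    and realisation_morphism:
      "\<lbrakk>realizes D A x B y C \<delta>; realizes D A' x' B' y' C' \<delta>';
        ext_morphism D A \<delta> C A' \<delta>' C' a c\<rbrakk>
        \<Longrightarrow> \<exists>b\<in>arr D B B'. b \<cdot> x = x' \<cdot> a \<and> y' \<cdot> b = c \<cdot> y"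
    and realisation_split:
      "is_biproduct D A C S i\<^sub>A i\<^sub>C p\<^sub>A p\<^sub>C \<Longrightarrow> realizes D A i\<^sub>A S p\<^sub>C C \<one>\<^bsub>Ext D C A\<^esub>"
    and realisation_sum:
      "\<lbrakk>realizes D A x B y C \<delta>; realizes D A' x' B' y' C' \<delta>';
        is_biproduct D A A' SA i\<^sub>A i\<^sub>A' p\<^sub>A p\<^sub>A';
        is_biproduct D B B' SB i\<^sub>B i\<^sub>B' p\<^sub>B p\<^sub>B';
        is_biproduct D C C' SC i\<^sub>C i\<^sub>C' p\<^sub>C p\<^sub>C';
        is_ext_sum D A \<delta> C A' \<delta>' C' SA p\<^sub>A p\<^sub>A' SC i\<^sub>C i\<^sub>C' \<epsilon>\<rbrakk>
        \<Longrightarrow> realizes D SA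
              ((i\<^sub>B \<cdot> (x \<cdot> p\<^sub>A)) \<otimes>\<^bsub>Mor D SA SB\<^esub> (i\<^sub>B' \<cdot> (x' \<cdot> p\<^sub>A')))
              SB
              ((i\<^sub>C \<cdot> (y \<cdot> p\<^sub>B)) \<otimes>\<^bsub>Mor D SB SC\<^esub> (i\<^sub>C' \<cdot> (y' \<cdot> p\<^sub>B')))
              SC \<epsilon>"
    and ET3:
      "\<lbrakk>realizes D A x B y C \<delta>; realizes D A' x' B' y' C' \<delta>';
        a \<in> arr D A A'; b \<in> arr D B B'; b \<cdot> x = x' \<cdot> a\<rbrakk>
        \<Longrightarrow> \<exists>c. ext_morphism D A \<delta> C A' \<delta>' C' a c \<and> c \<cdot> y = y' \<cdot> b"
    and ET3_op:
      "\<lbrakk>realizes D A x B y C \<delta>; realizes D A' x' B' y' C' \<delta>';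
        b \<in> arr D B B'; c \<in> arr D C C'; c \<cdot> y = y' \<cdot> b\<rbrakk>
        \<Longrightarrow> \<exists>a. ext_morphism D A \<delta> C A' \<delta>' C' a c \<and> b \<cdot> x = x' \<cdot> a"
    and ET4:
      "\<lbrakk>realizes D A f B f' X \<delta>; realizes D B g C g' F \<delta>'\<rbrakk>
        \<Longrightarrow> \<exists>Y h h' d e \<delta>''.
              realizes D A h C h' Y \<delta>'' \<and>
              realizes D X d Y e F (push D F f' \<delta>') \<and>
              h = g \<cdot> f \<and> h' \<cdot> g = d \<cdot> f' \<and> e \<cdot> h' = g' \<and>
              pull D A d \<delta>'' = \<delta> \<and>
              push D Y f \<delta>'' = pull D B e \<delta>'"
    and ET4_op:
      "\<lbrakk>realizes D X f' A f B \<delta>; realizes D F g' B g C \<delta>'\<rbrakk>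
        \<Longrightarrow> \<exists>Y h h' d e \<delta>''.
              realizes D Y h' A h C \<delta>'' \<and>
              realizes D X d Y e F (pull D X g' \<delta>) \<and>
              h = g \<cdot> f \<and> h' \<cdot> d = f' \<and> f \<cdot> h' = g' \<cdot> e \<and>
              \<delta>' = push D C e \<delta>'' \<and>
              push D B d \<delta> = pull D Y g \<delta>''"


section \<open>Negative first extensions\<close>

text \<open>
  \<open>NExt D C A\<close> is the group written \<open>E\<^sup>-\<^sup>1(C, A)\<close>.  For \<open>\<delta> \<in> E(C, A)\<close>, the component at \<open>W\<close> of
  \<open>\<delta>\<^sup>-\<^sup>1 : E\<^sup>-\<^sup>1(-, C) \<rightarrow> D(-, A)\<close> is \<open>conn_up D C A \<delta> W\<close>, and the component at \<open>W\<close> of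
  \<open>\<delta>\<^sub>-\<^sub>1 : E\<^sup>-\<^sup>1(A, -) \<rightarrow> D(C, -)\<close> is \<open>conn_low D C A \<delta> W\<close>.
\<close>

record ('o, 'm, 'e, 'n) neg_extri = "('o, 'm, 'e) extri" +
  NExt :: "'o \<Rightarrow> 'o \<Rightarrow> 'n monoid"
  next_map :: "'m \<Rightarrow> 'm \<Rightarrow> 'n \<Rightarrow> 'n"
  conn_up :: "'o \<Rightarrow> 'o \<Rightarrow> 'e \<Rightarrow> 'o \<Rightarrow> 'n \<Rightarrow> 'm"
  conn_low :: "'o \<Rightarrow> 'o \<Rightarrow> 'e \<Rightarrow> 'o \<Rightarrow> 'n \<Rightarrow> 'm"

text \<open>Exactness of \<open>G \<rightarrow> H \<rightarrow> K\<close> at \<open>H\<close>.\<close>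

definition exact_at :: "'a monoid \<Rightarrow> ('a \<Rightarrow> 'b) \<Rightarrow> 'b monoid \<Rightarrow> ('b \<Rightarrow> 'c) \<Rightarrow> 'c monoid \<Rightarrow> bool"
  where "exact_at G f H g K \<longleftrightarrow> f ` carrier G = kernel H K g"

locale extriangulated_category_neg =
    extriangulated_category D + N: additive_bifunctor D "NExt D" "next_map D"
    for D :: "('o, 'm, 'e, 'n, 'z) neg_extri_scheme" (structure) +
  assumes conn_up_hom:
      "\<lbrakk>A \<in> obj D; C \<in> obj D; \<delta> \<in> carrier (Ext D C A); W \<in> obj D\<rbrakk>
        \<Longrightarrow> conn_up D C A \<delta> W \<in> hom (NExt D W C) (Mor D W A)"
    and conn_up_natural:
      "\<lbrakk>A \<in> obj D; C \<in> obj D; \<delta> \<in> carrier (Ext D C A); W \<in> obj D; W' \<in> obj D;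
        w \<in> arr D W' W; u \<in> carrier (NExt D W C)\<rbrakk>
        \<Longrightarrow> conn_up D C A \<delta> W' (next_map D w (idm D C) u) = conn_up D C A \<delta> W u \<cdot> w"
    and conn_low_hom:
      "\<lbrakk>A \<in> obj D; C \<in> obj D; \<delta> \<in> carrier (Ext D C A); W \<in> obj D\<rbrakk>
        \<Longrightarrow> conn_low D C A \<delta> W \<in> hom (NExt D A W) (Mor D C W)"
    and conn_low_natural:
      "\<lbrakk>A \<in> obj D; C \<in> obj D; \<delta> \<in> carrier (Ext D C A); W \<in> obj D; W' \<in> obj D;
        w \<in> arr D W W'; u \<in> carrier (NExt D A W)\<rbrakk>
        \<Longrightarrow> conn_low D C A \<delta> W' (next_map D (idm D A) w u) = w \<cdot> conn_low D C A \<delta> W u"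
    and exact_up:
      "\<lbrakk>realizes D A x B y C \<delta>; W \<in> obj D\<rbrakk> \<Longrightarrow>
        exact_at (NExt D W A) (next_map D (idm D W) x) (NExt D W B)
                 (next_map D (idm D W) y) (NExt D W C) \<and>
        exact_at (NExt D W B) (next_map D (idm D W) y) (NExt D W C)
                 (conn_up D C A \<delta> W) (Mor D W A) \<and>
        exact_at (NExt D W C) (conn_up D C A \<delta> W) (Mor D W A)
                 (\<lambda>f. x \<cdot> f) (Mor D W B)"
    and exact_low:
      "\<lbrakk>realizes D A x B y C \<delta>; W \<in> obj D\<rbrakk> \<Longrightarrow>
        exact_at (NExt D C W) (next_map D y (idm D W)) (NExt D B W)
                 (next_map D x (idm D W)) (NExt D A W) \<and>
        exact_at (NExt D B W) (next_map D x (idm D W)) (NExt D A W)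
                 (conn_low D C A \<delta> W) (Mor D C W) \<and>
        exact_at (NExt D A W) (conn_low D C A \<delta> W) (Mor D C W)
                 (\<lambda>f. f \<cdot> y) (Mor D B W)"


section \<open>Torsion pairs and closure properties\<close>

text \<open>Full isomorphism-closed subcategories are given by their classes of objects.\<close>

definition full_iso_closed :: "('o, 'm, 'z) cat_scheme \<Rightarrow> 'o set \<Rightarrow> bool"
  where "full_iso_closed D Z \<longleftrightarrow>
    Z \<subseteq> obj D \<and> (\<forall>A\<in>Z. \<forall>B\<in>obj D. (\<exists>f. is_iso D A B f) \<longrightarrow> B \<in> Z)"

definition s_torsion_pair :: "('o, 'm, 'e, 'n, 'z) neg_extri_scheme \<Rightarrow> 'o set \<Rightarrow> 'o set \<Rightarrow> bool"
  where "s_torsion_pair D T F \<longleftrightarrow>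
    full_iso_closed D T \<and> full_iso_closed D F \<and>
    (\<forall>X\<in>T. \<forall>Y\<in>F. trivial_group (Mor D X Y)) \<and>
    (\<forall>X\<in>T. \<forall>Y\<in>F. trivial_group (NExt D X Y)) \<and>
    (\<forall>B\<in>obj D. \<exists>X\<in>T. \<exists>Y\<in>F. \<exists>x y. conflation D X x B y Y)"

definition closed_under_extensions :: "('o, 'm, 'e, 'z) extri_scheme \<Rightarrow> 'o set \<Rightarrow> bool"
  where "closed_under_extensions D Z \<longleftrightarrow>
    (\<forall>A x B y C. conflation D A x B y C \<and> A \<in> Z \<and> C \<in> Z \<longrightarrow> B \<in> Z)"

definition closed_under_cones :: "('o, 'm, 'e, 'z) extri_scheme \<Rightarrow> 'o set \<Rightarrow> bool"
  where "closed_under_cones D Z \<longleftrightarrow>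
    (\<forall>A x B y C. conflation D A x B y C \<and> A \<in> Z \<and> B \<in> Z \<longrightarrow> C \<in> Z)"

definition closed_under_cocones :: "('o, 'm, 'e, 'z) extri_scheme \<Rightarrow> 'o set \<Rightarrow> bool"
  where "closed_under_cocones D Z \<longleftrightarrow>
    (\<forall>A x B y C. conflation D A x B y C \<and> B \<in> Z \<and> C \<in> Z \<longrightarrow> A \<in> Z)"

definition closed_under_summands :: "('o, 'm, 'z) cat_scheme \<Rightarrow> 'o set \<Rightarrow> bool"
  where "closed_under_summands D Z \<longleftrightarrow>
    (\<forall>A B S i\<^sub>A i\<^sub>B p\<^sub>A p\<^sub>B. is_biproduct D A B S i\<^sub>A i\<^sub>B p\<^sub>A p\<^sub>B \<and> S \<in> Z \<longrightarrow> A \<in> Z)"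

definition right_neg_perp :: "('o, 'm, 'e, 'n, 'z) neg_extri_scheme \<Rightarrow> 'o set \<Rightarrow> 'o set"
  where "right_neg_perp D \<X> = {Y \<in> obj D. \<forall>X\<in>\<X>. trivial_group (NExt D X Y)}"

definition left_neg_perp :: "('o, 'm, 'e, 'n, 'z) neg_extri_scheme \<Rightarrow> 'o set \<Rightarrow> 'o set"
  where "left_neg_perp D \<X> = {Y \<in> obj D. \<forall>X\<in>\<X>. trivial_group (NExt D Y X)}"

end

theory Submission
  imports Defs
begin

text \<open>
  For a conflation \<open>X \<rightarrow> B \<rightarrow> Y\<close> with \<open>X\<close> in \<open>T\<close> and \<open>Y\<close> in \<open>F\<close>, the vanishing of
  \<open>E\<^sup>-\<^sup>1(X, Y)\<close> makes composition with \<open>x\<close> injective on \<open>D(X, X)\<close> and composition with \<open>y\<close>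
  injective on \<open>D(Y, Y)\<close>.  If \<open>y = 0\<close>, then \<open>x\<close> is a split epimorphism by weak exactness of the
  conflation, hence an isomorphism; dually for \<open>x = 0\<close>.  Therefore each class of an s-torsion pair
  is the Hom-orthogonal of the other one, and everything else follows from the long exact sequences.
\<close>

section \<open>Preliminaries on trivial groups, exactness and split morphisms\<close>

lemma trivial_group_iff:
  assumes "group G"
  shows "trivial_group G \<longleftrightarrow> (\<forall>x\<in>carrier G. x = \<one>\<^bsub>G\<^esub>)"
  using assms group.is_monoid[OF assms] monoid.one_closed
  unfolding trivial_group_def by blast

text \<open>Exactness places \<open>h\<close> in the image of a trivial group, and a homomorphism
  sends the identity to the identity. This is how every vanishing statement is read off the long
  exact sequences.\<close>

lemma exact_at_imp_one:
  assumes "exact_at G f H g K" and "trivial_group G" and "f \<in> hom G H" and "group H"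
    and "h \<in> carrier H" and "g h = \<one>\<^bsub>K\<^esub>"
  shows "h = \<one>\<^bsub>H\<^esub>"
proof -
  have "h \<in> f ` carrier G"
    using assms(1,5,6) by (simp add: exact_at_def kernel_def)
  moreover have "carrier G = {\<one>\<^bsub>G\<^esub>}" and "group G"
    using assms(2) by (auto simp: trivial_group_def)
  ultimately show ?thesis
    using hom_one[OF assms(3)] assms(4) by auto
qed

text \<open>A homomorphism with trivial kernel is injective. Applied to composition with a fixed
  morphism, it turns "only zero is killed" into a cancellation law.\<close>

lemma hom_eq_if_kernel_trivial:
  assumes "group G" and "group H" and "\<phi> \<in> hom G H"
    and "f \<in> carrier G" and "g \<in> carrier G" and "\<phi> f = \<phi> g"
    and "\<And>h. \<lbrakk>h \<in> carrier G; \<phi> h = \<one>\<^bsub>H\<^esub>\<rbrakk> \<Longrightarrow> h = \<one>\<^bsub>G\<^esub>"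
  shows "f = g"
proof -
  have "group_hom G H \<phi>"
    using assms(1-3) by (simp add: group_hom_def group_hom_axioms_def)
  then have "inj_on \<phi> (carrier G)"
    using assms(7) by (simp add: group_hom.inj_on_one_iff)
  then show ?thesis
    using assms(4-6) by (simp add: inj_on_def)
qed

lemma realizes_in_obj:
  assumes "realizes D A x B y C \<delta>"
  shows "A \<in> obj D" "B \<in> obj D" "C \<in> obj D" "x \<in> arr D A B" "y \<in> arr D B C"
    "\<delta> \<in> carrier (Ext D C A)"
  using assms by (auto simp: realizes_def sequences_def)

text \<open>Since \<open>x (s x) = (x s) x = x\<close>, cancelling \<open>x\<close> yields that
  \<open>s x\<close> is the identity. Cancellation is demanded among endomorphisms of
  \<open>A\<close> alone, which is what vanishing of a single negative extension group
  provides.\<close>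

lemma is_iso_if_split_epi_cancel:
  assumes "preadditive_category D" and "A \<in> obj D" and "B \<in> obj D"
    and "x \<in> arr D A B" and "s \<in> arr D B A" and "x \<cdot>\<^bsub>D\<^esub> s = idm D B"
    and cancel: "\<And>f g. \<lbrakk>f \<in> arr D A A; g \<in> arr D A A; x \<cdot>\<^bsub>D\<^esub> f = x \<cdot>\<^bsub>D\<^esub> g\<rbrakk> \<Longrightarrow> f = g"
  shows "is_iso D A B x"
proof -
  interpret preadditive_category D by fact
  have eq: "x \<cdot>\<^bsub>D\<^esub> (s \<cdot>\<^bsub>D\<^esub> x) = x \<cdot>\<^bsub>D\<^esub> idm D A"
    using assms(2-6) by (simp add: cmp_assoc[of A B A B] idm_left[of A B] idm_right[of A B])
  have "s \<cdot>\<^bsub>D\<^esub> x = idm D A"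
    using cancel[OF cmp_closed[OF assms(2,3,2,4,5)] idm_closed[OF assms(2)] eq] by simp
  then show ?thesis
    using assms(4-6) by (auto simp: is_iso_def)
qed

text \<open>Dual argument: \<open>(y s) y = y (s y) = y\<close>, and \<open>y\<close> is cancelled
  on the right.\<close>

lemma is_iso_if_split_mono_cancel:
  assumes "preadditive_category D" and "A \<in> obj D" and "B \<in> obj D"
    and "y \<in> arr D A B" and "s \<in> arr D B A" and "s \<cdot>\<^bsub>D\<^esub> y = idm D A"
    and cancel: "\<And>f g. \<lbrakk>f \<in> arr D B B; g \<in> arr D B B; f \<cdot>\<^bsub>D\<^esub> y = g \<cdot>\<^bsub>D\<^esub> y\<rbrakk> \<Longrightarrow> f = g"
  shows "is_iso D A B y"
proof -
  interpret preadditive_category D by fact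
  have eq: "(y \<cdot>\<^bsub>D\<^esub> s) \<cdot>\<^bsub>D\<^esub> y = idm D B \<cdot>\<^bsub>D\<^esub> y"
    using assms(2-6) by (simp add: cmp_assoc[of A B A B, symmetric] idm_left[of A B] idm_right[of A B])
  have "y \<cdot>\<^bsub>D\<^esub> s = idm D B"
    using cancel[OF cmp_closed[OF assms(3,2,3,5,4)] idm_closed[OF assms(3)] eq] by simp
  then show ?thesis
    using assms(4-6) by (auto simp: is_iso_def)
qed

lemma is_iso_inverse:
  assumes "is_iso D A B f"
  shows "\<exists>g. is_iso D B A g"
  using assms by (auto simp: is_iso_def)

section \<open>Zero morphisms and zero objects in preadditive categories\<close>

context preadditive_category
begin

lemma zero_closed: "\<lbrakk>A \<in> obj D; B \<in> obj D\<rbrakk> \<Longrightarrow> \<one>\<^bsub>Mor D A B\<^esub> \<in> arr D A B"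
  by (simp add: hom_group comm_group.axioms(2) group.is_monoid monoid.one_closed)

lemma hom_group': "\<lbrakk>A \<in> obj D; B \<in> obj D\<rbrakk> \<Longrightarrow> group (Mor D A B)"
  by (simp add: hom_group comm_group.axioms(2))

lemma cmp_left_hom:
  "\<lbrakk>A \<in> obj D; B \<in> obj D; C \<in> obj D; g \<in> arr D B C\<rbrakk> \<Longrightarrow> (\<lambda>f. g \<cdot> f) \<in> hom (Mor D A B) (Mor D A C)"
  by (auto intro!: homI simp: cmp_closed[of A B C] cmp_add_right[of A B C])

lemma cmp_right_hom:
  "\<lbrakk>A \<in> obj D; B \<in> obj D; C \<in> obj D; f \<in> arr D A B\<rbrakk> \<Longrightarrow> (\<lambda>g. g \<cdot> f) \<in> hom (Mor D B C) (Mor D A C)"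
  by (auto intro!: homI simp: cmp_closed[of A B C] cmp_add_left[of A B C])

lemma cmp_zero:
  "\<lbrakk>A \<in> obj D; B \<in> obj D; C \<in> obj D; g \<in> arr D B C\<rbrakk> \<Longrightarrow> g \<cdot> \<one>\<^bsub>Mor D A B\<^esub> = \<one>\<^bsub>Mor D A C\<^esub>"
  using hom_one[OF cmp_left_hom hom_group' hom_group'] by blast

lemma zero_cmp:
  "\<lbrakk>A \<in> obj D; B \<in> obj D; C \<in> obj D; f \<in> arr D A B\<rbrakk> \<Longrightarrow> \<one>\<^bsub>Mor D B C\<^esub> \<cdot> f = \<one>\<^bsub>Mor D A C\<^esub>"
  using hom_one[OF cmp_right_hom hom_group' hom_group'] by blast

text \<open>Adding a zero object changes nothing, so \<open>W\<close> is its own biproduct with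
  \<open>Z\<close>. Through \<open>realisation_split\<close> this yields the split conflations
  \<open>Z -> W -> W\<close> and \<open>W -> W -> Z\<close>, whose nonzero part is the identity of
  \<open>W\<close>.\<close>

lemma is_zero_object_biproduct:
  assumes "is_zero_object D Z" and W: "W \<in> obj D"
  shows "is_biproduct D Z W W \<one>\<^bsub>Mor D Z W\<^esub> (idm D W) \<one>\<^bsub>Mor D W Z\<^esub> (idm D W)"
    and "is_biproduct D W Z W (idm D W) \<one>\<^bsub>Mor D Z W\<^esub> (idm D W) \<one>\<^bsub>Mor D W Z\<^esub>"
proof -
  \<comment> \<open>Both morphisms are endomorphisms of \<open>Z\<close>, and a zero object has only
    one.\<close>
  have Z: "Z \<in> obj D" and "idm D Z = \<one>\<^bsub>Mor D Z Z\<^esub>"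
    using assms(1) idm_closed[of Z] zero_closed[of Z Z] by (auto simp: is_zero_object_def)
  moreover have "comm_group (Mor D W W)"
    using W hom_group by simp
  then have "monoid (Mor D W W)"
    by (simp add: comm_group_def group_def)
  ultimately show
    "is_biproduct D Z W W \<one>\<^bsub>Mor D Z W\<^esub> (idm D W) \<one>\<^bsub>Mor D W Z\<^esub> (idm D W)"
    "is_biproduct D W Z W (idm D W) \<one>\<^bsub>Mor D Z W\<^esub> (idm D W) \<one>\<^bsub>Mor D W Z\<^esub>"
    using W zero_closed[of W Z] zero_closed[of Z W] idm_closed[of W]
    by (simp_all add: is_biproduct_def cmp_zero[of _ _ _ "\<one>\<^bsub>Mor D W Z\<^esub>"]
        cmp_zero[of W Z W] zero_cmp[of Z W Z] idm_left[of W W] idm_left[of Z W]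
        idm_right[of W W] idm_right[of W Z] monoid.l_one monoid.r_one)
qed

end

section \<open>Weak kernels and weak cokernels of conflations\<close>

context extriangulated_category
begin

text \<open>\<open>ET3\<close> maps the given conflation to the split one
  \<open>Z -> W -> W\<close>, with the zero morphism \<open>A -> Z\<close> on the left and
  \<open>f\<close> in the middle. The third component \<open>c\<close> then satisfies
  \<open>c y = f\<close>, because the deflation of the split conflation is an identity.\<close>

lemma conflation_weak_cokernel:
  assumes "realizes D A x B y C \<delta>" and W: "W \<in> obj D"
    and f: "f \<in> arr D B W" and "f \<cdot> x = \<one>\<^bsub>Mor D A W\<^esub>"
  shows "\<exists>g\<in>arr D C W. g \<cdot> y = f"
proof -
  note r = realizes_in_obj[OF assms(1)]
  obtain Z where Z: "is_zero_object D Z"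
    using has_zero_object by blast
  then have Z': "Z \<in> obj D"
    by (simp add: is_zero_object_def)
  have "f \<cdot> x = \<one>\<^bsub>Mor D Z W\<^esub> \<cdot> \<one>\<^bsub>Mor D A Z\<^esub>"
    using assms(4) r(1) W Z' zero_closed cmp_zero[of A Z W] by simp
  then obtain c where "ext_morphism D A \<delta> C Z \<one>\<^bsub>Ext D W Z\<^esub> W \<one>\<^bsub>Mor D A Z\<^esub> c" "c \<cdot> y = idm D W \<cdot> f"
    using ET3[OF assms(1) realisation_split[OF is_zero_object_biproduct(1)[OF Z W]]
        zero_closed[OF r(1) Z'] f] by blast
  then show ?thesis
    using idm_left[OF r(2) W f] by (auto simp: ext_morphism_def)
qed

text \<open>Dually, \<open>ET3_op\<close> maps the split conflation \<open>W -> W -> Z\<close> to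
  the given one, with \<open>f\<close> in the middle and zero on the right. The resulting component
  \<open>W -> A\<close> is the required lift.\<close>

lemma conflation_weak_kernel:
  assumes "realizes D A x B y C \<delta>" and W: "W \<in> obj D"
    and f: "f \<in> arr D W B" and "y \<cdot> f = \<one>\<^bsub>Mor D W C\<^esub>"
  shows "\<exists>g\<in>arr D W A. x \<cdot> g = f"
proof -
  note r = realizes_in_obj[OF assms(1)]
  obtain Z where Z: "is_zero_object D Z"
    using has_zero_object by blast
  then have Z': "Z \<in> obj D"
    by (simp add: is_zero_object_def)
  have "\<one>\<^bsub>Mor D Z C\<^esub> \<cdot> \<one>\<^bsub>Mor D W Z\<^esub> = y \<cdot> f"
    using assms(4) r(3) W Z' zero_closed cmp_zero[of W Z C] by simp
  then obtain a where "ext_morphism D W \<one>\<^bsub>Ext D Z W\<^esub> Z A \<delta> C a \<one>\<^bsub>Mor D Z C\<^esub>" "f \<cdot> idm D W = x \<cdot> a"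
    using ET3_op[OF realisation_split[OF is_zero_object_biproduct(2)[OF Z W]] assms(1)
        f zero_closed[OF Z' r(3)]] by blast
  then show ?thesis
    using idm_right[OF W r(2) f] by (auto simp: ext_morphism_def)
qed

end

section \<open>Cancellation from vanishing negative extensions\<close>

context extriangulated_category_neg
begin

lemma NExt_group: "\<lbrakk>C \<in> obj D; A \<in> obj D\<rbrakk> \<Longrightarrow> group (NExt D C A)"
  using N.bif_group comm_group.axioms(2) by blast

text \<open>This is exactness of \<open>NExt D W C -> Mor D W A -> Mor D W B\<close> at the middle
  term, the left term being trivial.\<close>

lemma inflation_cmp_eq_zero:
  assumes "realizes D A x B y C \<delta>" and "W \<in> obj D" and "trivial_group (NExt D W C)"
    and "f \<in> arr D W A" and "x \<cdot> f = \<one>\<^bsub>Mor D W B\<^esub>"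
  shows "f = \<one>\<^bsub>Mor D W A\<^esub>"
proof -
  note r = realizes_in_obj[OF assms(1)]
  show ?thesis
    using exact_at_imp_one[OF conjunct2[OF conjunct2[OF exact_up[OF assms(1,2)]]] assms(3)
        conn_up_hom[OF r(1,3,6) assms(2)] hom_group'[OF assms(2) r(1)] assms(4,5)] .
qed

text \<open>The contravariant counterpart: exactness of
  \<open>NExt D A W -> Mor D C W -> Mor D B W\<close> at the middle term.\<close>

lemma cmp_deflation_eq_zero:
  assumes "realizes D A x B y C \<delta>" and "W \<in> obj D" and "trivial_group (NExt D A W)"
    and "f \<in> arr D C W" and "f \<cdot> y = \<one>\<^bsub>Mor D B W\<^esub>"
  shows "f = \<one>\<^bsub>Mor D C W\<^esub>"
proof -
  note r = realizes_in_obj[OF assms(1)]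
  show ?thesis
    using exact_at_imp_one[OF conjunct2[OF conjunct2[OF exact_low[OF assms(1,2)]]] assms(3)
        conn_low_hom[OF r(1,3,6) assms(2)] hom_group'[OF r(3) assms(2)] assms(4,5)] .
qed

section \<open>s-torsion pairs and Hom-orthogonality\<close>

lemma s_torsion_pairD:
  assumes "s_torsion_pair D T F"
  shows "\<And>X. X \<in> T \<Longrightarrow> X \<in> obj D" and "\<And>Y. Y \<in> F \<Longrightarrow> Y \<in> obj D"
    and "\<And>X Y f. \<lbrakk>X \<in> T; Y \<in> F; f \<in> arr D X Y\<rbrakk> \<Longrightarrow> f = \<one>\<^bsub>Mor D X Y\<^esub>"
    and "\<And>X Y. \<lbrakk>X \<in> T; Y \<in> F\<rbrakk> \<Longrightarrow> trivial_group (NExt D X Y)"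
  using assms by (auto simp: s_torsion_pair_def full_iso_closed_def trivial_group_def)

lemma s_torsion_pair_iso_closed:
  assumes "s_torsion_pair D T F"
  shows "\<And>A B f. \<lbrakk>A \<in> T; B \<in> obj D; is_iso D A B f\<rbrakk> \<Longrightarrow> B \<in> T"
    and "\<And>A B f. \<lbrakk>A \<in> F; B \<in> obj D; is_iso D A B f\<rbrakk> \<Longrightarrow> B \<in> F"
proof -
  have "full_iso_closed D T" and "full_iso_closed D F"
    using assms by (simp_all add: s_torsion_pair_def)
  then show "\<And>A B f. \<lbrakk>A \<in> T; B \<in> obj D; is_iso D A B f\<rbrakk> \<Longrightarrow> B \<in> T"
    and "\<And>A B f. \<lbrakk>A \<in> F; B \<in> obj D; is_iso D A B f\<rbrakk> \<Longrightarrow> B \<in> F"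
    unfolding full_iso_closed_def by blast+
qed

lemma s_torsion_pair_conflationE:
  assumes "s_torsion_pair D T F" and "B \<in> obj D"
  obtains X Y x y \<delta> where "X \<in> T" and "Y \<in> F" and "realizes D X x B y Y \<delta>"
proof -
  have "\<exists>X\<in>T. \<exists>Y\<in>F. \<exists>x y. conflation D X x B y Y"
    using assms by (simp add: s_torsion_pair_def)
  then show thesis
    unfolding conflation_def using that by blast
qed

theorem torsion_class_eq_hom_perp:
  assumes st: "s_torsion_pair D T F"
  shows "T = {B \<in> obj D. \<forall>Y\<in>F. \<forall>f\<in>arr D B Y. f = \<one>\<^bsub>Mor D B Y\<^esub>}"
proof (intro equalityI subsetI)
  fix B assume "B \<in> {B \<in> obj D. \<forall>Y\<in>F. \<forall>f\<in>arr D B Y. f = \<one>\<^bsub>Mor D B Y\<^esub>}"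
  then have B: "B \<in> obj D" and perp: "\<And>Y f. \<lbrakk>Y \<in> F; f \<in> arr D B Y\<rbrakk> \<Longrightarrow> f = \<one>\<^bsub>Mor D B Y\<^esub>"
    by auto
  obtain X Y x y \<delta> where X: "X \<in> T" and Y: "Y \<in> F" and R: "realizes D X x B y Y \<delta>"
    using s_torsion_pair_conflationE[OF st B] .
  note r = realizes_in_obj[OF R]
  \<comment> \<open>Orthogonality forces \<open>y = 0\<close>, so the identity of \<open>B\<close>
    lifts along \<open>x\<close>; the lift \<open>s\<close> is a section of
    \<open>x\<close>.\<close>
  have "y \<cdot> idm D B = \<one>\<^bsub>Mor D B Y\<^esub>"
    using perp[OF Y r(5)] idm_right[OF B r(3) r(5)] by simp
  then obtain s where s: "s \<in> arr D B X" "x \<cdot> s = idm D B"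
    using conflation_weak_kernel[OF R B idm_closed[OF B]] by blast
  have "is_iso D X B x"
  proof (rule is_iso_if_split_epi_cancel[OF preadditive_category_axioms r(1) B r(4) s])
    \<comment> \<open>Cancellation of \<open>x\<close> comes from the vanishing of
      \<open>NExt D X Y\<close>, with \<open>X\<close> itself as test object.\<close>
    fix f g assume "f \<in> arr D X X" "g \<in> arr D X X" "x \<cdot> f = x \<cdot> g"
    then show "f = g"
      by (rule hom_eq_if_kernel_trivial[OF hom_group'[OF r(1) r(1)] hom_group'[OF r(1) B]
            cmp_left_hom[OF r(1) r(1) B r(4)]])
        (rule inflation_cmp_eq_zero[OF R r(1) s_torsion_pairD(4)[OF st X Y]])
  qed
  then show "B \<in> T"
    using s_torsion_pair_iso_closed(1)[OF st X B] by simp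
\<comment> \<open>The inclusion left over is part of the definition: objects of \<open>T\<close>
  have only zero morphisms to objects of \<open>F\<close>.\<close>
qed (use s_torsion_pairD(1-3)[OF st] in blast)

theorem torsion_free_class_eq_hom_perp:
  assumes st: "s_torsion_pair D T F"
  shows "F = {B \<in> obj D. \<forall>X\<in>T. \<forall>f\<in>arr D X B. f = \<one>\<^bsub>Mor D X B\<^esub>}"
proof (intro equalityI subsetI)
  fix B assume "B \<in> {B \<in> obj D. \<forall>X\<in>T. \<forall>f\<in>arr D X B. f = \<one>\<^bsub>Mor D X B\<^esub>}"
  then have B: "B \<in> obj D" and perp: "\<And>X f. \<lbrakk>X \<in> T; f \<in> arr D X B\<rbrakk> \<Longrightarrow> f = \<one>\<^bsub>Mor D X B\<^esub>"
    by auto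
  obtain X Y x y \<delta> where X: "X \<in> T" and Y: "Y \<in> F" and R: "realizes D X x B y Y \<delta>"
    using s_torsion_pair_conflationE[OF st B] .
  note r = realizes_in_obj[OF R]
  \<comment> \<open>Here \<open>x = 0\<close>, so the identity of \<open>B\<close> factors through
    \<open>y\<close>; the factor \<open>s\<close> is a retraction of \<open>y\<close>.\<close>
  have "idm D B \<cdot> x = \<one>\<^bsub>Mor D X B\<^esub>"
    using perp[OF X r(4)] idm_left[OF r(1) B r(4)] by simp
  then obtain s where s: "s \<in> arr D Y B" "s \<cdot> y = idm D B"
    using conflation_weak_cokernel[OF R B idm_closed[OF B]] by blast
  have "is_iso D B Y y"
  proof (rule is_iso_if_split_mono_cancel[OF preadditive_category_axioms B r(3) r(5) s])
    fix f g assume "f \<in> arr D Y Y" "g \<in> arr D Y Y" "f \<cdot> y = g \<cdot> y"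
    then show "f = g"
      by (rule hom_eq_if_kernel_trivial[OF hom_group'[OF r(3) r(3)] hom_group'[OF B r(3)]
            cmp_right_hom[OF B r(3) r(3) r(5)]])
        (rule cmp_deflation_eq_zero[OF R r(3) s_torsion_pairD(4)[OF st X Y]])
  qed
  \<comment> \<open>The isomorphism found goes from \<open>B\<close> to \<open>Y\<close>, whereas
    closure under isomorphism starts from the known member \<open>Y\<close>; hence the
    inverse.\<close>
  then show "B \<in> F"
    using s_torsion_pair_iso_closed(2)[OF st Y B] is_iso_inverse[of D B Y y] by auto
qed (use s_torsion_pairD(1-3)[OF st] in blast)

section \<open>Membership tests by vanishing morphisms, and closure properties\<close>

lemma torsion_classI:
  assumes "s_torsion_pair D T F" and "B \<in> obj D"
    and "\<And>Y f. \<lbrakk>Y \<in> F; Y \<in> obj D; f \<in> arr D B Y\<rbrakk> \<Longrightarrow> f = \<one>\<^bsub>Mor D B Y\<^esub>"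
  shows "B \<in> T"
  using assms s_torsion_pairD(2)[OF assms(1)] by (subst torsion_class_eq_hom_perp[OF assms(1)]) blast

lemma torsion_free_classI:
  assumes "s_torsion_pair D T F" and "B \<in> obj D"
    and "\<And>X f. \<lbrakk>X \<in> T; X \<in> obj D; f \<in> arr D X B\<rbrakk> \<Longrightarrow> f = \<one>\<^bsub>Mor D X B\<^esub>"
  shows "B \<in> F"
  using assms s_torsion_pairD(1)[OF assms(1)] by (subst torsion_free_class_eq_hom_perp[OF assms(1)]) blast

text \<open>A morphism \<open>C -> Y\<close> with \<open>Y\<close> in \<open>F\<close> becomes zero
  after composition with the deflation, since \<open>B\<close> lies in \<open>T\<close>. As
  \<open>NExt D A Y\<close> vanishes, it was already zero.\<close>

lemma torsion_class_closed_under_cones: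
  assumes st: "s_torsion_pair D T F"
  shows "closed_under_cones D T"
  unfolding closed_under_cones_def
proof (intro allI impI, elim conjE)
  fix A x B y C assume "conflation D A x B y C" and A: "A \<in> T" and B: "B \<in> T"
  then obtain \<delta> where R: "realizes D A x B y C \<delta>"
    by (auto simp: conflation_def)
  note r = realizes_in_obj[OF R]
  show "C \<in> T"
  proof (rule torsion_classI[OF st r(3)])
    fix Y f assume Y: "Y \<in> F" "Y \<in> obj D" and f: "f \<in> arr D C Y"
    have "f \<cdot> y = \<one>\<^bsub>Mor D B Y\<^esub>"
      using s_torsion_pairD(3)[OF st B Y(1)] cmp_closed[OF r(2,3) Y(2) r(5) f] .
    then show "f = \<one>\<^bsub>Mor D C Y\<^esub>"
      using cmp_deflation_eq_zero[OF R Y(2) s_torsion_pairD(4)[OF st A Y(1)] f] by simp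
  qed
qed

text \<open>A morphism \<open>B -> Y\<close> vanishes on \<open>A\<close>, hence factors through
  \<open>C\<close>, and every morphism \<open>C -> Y\<close> is zero.\<close>

lemma torsion_class_closed_under_extensions:
  assumes st: "s_torsion_pair D T F"
  shows "closed_under_extensions D T"
  unfolding closed_under_extensions_def
proof (intro allI impI, elim conjE)
  fix A x B y C assume "conflation D A x B y C" and A: "A \<in> T" and C: "C \<in> T"
  then obtain \<delta> where R: "realizes D A x B y C \<delta>"
    by (auto simp: conflation_def)
  note r = realizes_in_obj[OF R]
  show "B \<in> T"
  proof (rule torsion_classI[OF st r(2)])
    fix Y f assume Y: "Y \<in> F" "Y \<in> obj D" and f: "f \<in> arr D B Y"
    have "f \<cdot> x = \<one>\<^bsub>Mor D A Y\<^esub>"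
      using s_torsion_pairD(3)[OF st A Y(1)] cmp_closed[OF r(1,2) Y(2) r(4) f] .
    then obtain g where "g \<in> arr D C Y" "g \<cdot> y = f"
      using conflation_weak_cokernel[OF R Y(2) f] by blast
    then show "f = \<one>\<^bsub>Mor D B Y\<^esub>"
      using s_torsion_pairD(3)[OF st C Y(1)] zero_cmp[OF r(2,3) Y(2) r(5)] by blast
  qed
qed

text \<open>A summand is a retract: a morphism out of \<open>A\<close> is recovered from its
  composite with the projection, which is a morphism out of \<open>S\<close> and therefore
  zero.\<close>

lemma torsion_class_closed_under_summands:
  assumes st: "s_torsion_pair D T F"
  shows "closed_under_summands D T"
  unfolding closed_under_summands_def
proof (intro allI impI, elim conjE)
  fix A B S i\<^sub>A i\<^sub>B p\<^sub>A p\<^sub>B assume "is_biproduct D A B S i\<^sub>A i\<^sub>B p\<^sub>A p\<^sub>B" and S: "S \<in> T"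
  then have A: "A \<in> obj D" and S': "S \<in> obj D" and i: "i\<^sub>A \<in> arr D A S" and p: "p\<^sub>A \<in> arr D S A"
    and pi: "p\<^sub>A \<cdot> i\<^sub>A = idm D A"
    by (auto simp: is_biproduct_def)
  show "A \<in> T"
  proof (rule torsion_classI[OF st A])
    fix Y f assume Y: "Y \<in> F" "Y \<in> obj D" and f: "f \<in> arr D A Y"
    have "f \<cdot> p\<^sub>A = \<one>\<^bsub>Mor D S Y\<^esub>"
      using s_torsion_pairD(3)[OF st S Y(1)] cmp_closed[OF S' A Y(2) p f] .
    then have "(f \<cdot> p\<^sub>A) \<cdot> i\<^sub>A = \<one>\<^bsub>Mor D A Y\<^esub>"
      using zero_cmp[OF A S' Y(2) i] by simp
    then show "f = \<one>\<^bsub>Mor D A Y\<^esub>"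
      using cmp_assoc[OF A S' A Y(2) i p f] idm_right[OF A Y(2) f] pi by simp
  qed
qed

text \<open>Dual to cones: a morphism \<open>X -> A\<close> dies in \<open>B\<close>, and the
  vanishing of \<open>NExt D X C\<close> makes the inflation detect zero.\<close>

lemma torsion_free_class_closed_under_cocones:
  assumes st: "s_torsion_pair D T F"
  shows "closed_under_cocones D F"
  unfolding closed_under_cocones_def
proof (intro allI impI, elim conjE)
  fix A x B y C assume "conflation D A x B y C" and B: "B \<in> F" and C: "C \<in> F"
  then obtain \<delta> where R: "realizes D A x B y C \<delta>"
    by (auto simp: conflation_def)
  note r = realizes_in_obj[OF R]
  show "A \<in> F"
  proof (rule torsion_free_classI[OF st r(1)])
    fix X f assume X: "X \<in> T" "X \<in> obj D" and f: "f \<in> arr D X A"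
    have "x \<cdot> f = \<one>\<^bsub>Mor D X B\<^esub>"
      using s_torsion_pairD(3)[OF st X(1) B] cmp_closed[OF X(2) r(1,2) f r(4)] .
    then show "f = \<one>\<^bsub>Mor D X A\<^esub>"
      using inflation_cmp_eq_zero[OF R X(2) s_torsion_pairD(4)[OF st X(1) C] f] by simp
  qed
qed

text \<open>A morphism \<open>X -> B\<close> dies in \<open>C\<close>, so it lifts to
  \<open>A\<close>, where it must be zero.\<close>

lemma torsion_free_class_closed_under_extensions:
  assumes st: "s_torsion_pair D T F"
  shows "closed_under_extensions D F"
  unfolding closed_under_extensions_def
proof (intro allI impI, elim conjE)
  fix A x B y C assume "conflation D A x B y C" and A: "A \<in> F" and C: "C \<in> F"
  then obtain \<delta> where R: "realizes D A x B y C \<delta>"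
    by (auto simp: conflation_def)
  note r = realizes_in_obj[OF R]
  show "B \<in> F"
  proof (rule torsion_free_classI[OF st r(2)])
    fix X f assume X: "X \<in> T" "X \<in> obj D" and f: "f \<in> arr D X B"
    have "y \<cdot> f = \<one>\<^bsub>Mor D X C\<^esub>"
      using s_torsion_pairD(3)[OF st X(1) C] cmp_closed[OF X(2) r(2,3) f r(5)] .
    then obtain g where "g \<in> arr D X A" "x \<cdot> g = f"
      using conflation_weak_kernel[OF R X(2) f] by blast
    then show "f = \<one>\<^bsub>Mor D X B\<^esub>"
      using s_torsion_pairD(3)[OF st X(1) A] cmp_zero[OF X(2) r(1,2) r(4)] by blast
  qed
qed

text \<open>A morphism into \<open>A\<close> is recovered from its composite with the injection into
  \<open>S\<close>, which is zero.\<close>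

lemma torsion_free_class_closed_under_summands:
  assumes st: "s_torsion_pair D T F"
  shows "closed_under_summands D F"
  unfolding closed_under_summands_def
proof (intro allI impI, elim conjE)
  fix A B S i\<^sub>A i\<^sub>B p\<^sub>A p\<^sub>B assume "is_biproduct D A B S i\<^sub>A i\<^sub>B p\<^sub>A p\<^sub>B" and S: "S \<in> F"
  then have A: "A \<in> obj D" and S': "S \<in> obj D" and i: "i\<^sub>A \<in> arr D A S" and p: "p\<^sub>A \<in> arr D S A"
    and pi: "p\<^sub>A \<cdot> i\<^sub>A = idm D A"
    by (auto simp: is_biproduct_def)
  show "A \<in> F"
  proof (rule torsion_free_classI[OF st A])
    fix X f assume X: "X \<in> T" "X \<in> obj D" and f: "f \<in> arr D X A"
    have "i\<^sub>A \<cdot> f = \<one>\<^bsub>Mor D X S\<^esub>"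
      using s_torsion_pairD(3)[OF st X(1) S] cmp_closed[OF X(2) A S' f i] .
    then have "p\<^sub>A \<cdot> (i\<^sub>A \<cdot> f) = \<one>\<^bsub>Mor D X A\<^esub>"
      using cmp_zero[OF X(2) S' A p] by simp
    then show "f = \<one>\<^bsub>Mor D X A\<^esub>"
      using cmp_assoc[OF X(2) A S' A f i p] idm_left[OF X(2) A f] pi by simp
  qed
qed

section \<open>Negative perpendicular classes and comparison of torsion pairs\<close>

lemma cocone_in_left_neg_perp:
  assumes st: "s_torsion_pair D T F" and "conflation D X x Y y Z" and "Y \<in> T" and "Z \<in> T"
  shows "X \<in> left_neg_perp D F"
proof -
  obtain \<delta> where R: "realizes D X x Y y Z \<delta>"
    using assms(2) by (auto simp: conflation_def)
  note r = realizes_in_obj[OF R]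
  have "trivial_group (NExt D X W)" if "W \<in> F" for W
  proof -
    have W: "W \<in> obj D"
      using s_torsion_pairD(2)[OF st that] .
    \<comment> \<open>In the exact sequence \<open>NExt D Y W -> NExt D X W -> Mor D Z W\<close>
      both outer groups vanish: the first because \<open>Y\<close> lies in \<open>T\<close>, the
      last because \<open>Z\<close> does.\<close>
    have "u = \<one>\<^bsub>NExt D X W\<^esub>" if u: "u \<in> carrier (NExt D X W)" for u
    proof (rule exact_at_imp_one[OF conjunct1[OF conjunct2[OF exact_low[OF R W]]]])
      show "next_map D x (idm D W) \<in> hom (NExt D Y W) (NExt D X W)"
        using N.bif_hom[OF r(2,1) W W r(4) idm_closed[OF W]] .
      show "conn_low D Z X \<delta> W u = \<one>\<^bsub>Mor D Z W\<^esub>"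
        using conn_low_hom[OF r(1,3,6) W] u
        by (intro s_torsion_pairD(3)[OF st \<open>Z \<in> T\<close> \<open>W \<in> F\<close>]) (auto simp: hom_def)
    qed (use u r W NExt_group s_torsion_pairD(4)[OF st \<open>Y \<in> T\<close> \<open>W \<in> F\<close>] in auto)
    then show ?thesis
      using trivial_group_iff[OF NExt_group[OF r(1) W]] by blast
  qed
  then show ?thesis
    using r(1) by (simp add: left_neg_perp_def)
qed

text \<open>The middle term of \<open>NExt D W Y -> NExt D W Z -> Mor D W X\<close> is squeezed
  between two trivial groups when \<open>W\<close> lies in \<open>T\<close>.\<close>

lemma cone_in_right_neg_perp:
  assumes st: "s_torsion_pair D T F" and "conflation D X x Y y Z" and "X \<in> F" and "Y \<in> F"
  shows "Z \<in> right_neg_perp D T"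
proof -
  obtain \<delta> where R: "realizes D X x Y y Z \<delta>"
    using assms(2) by (auto simp: conflation_def)
  note r = realizes_in_obj[OF R]
  have "trivial_group (NExt D W Z)" if "W \<in> T" for W
  proof -
    have W: "W \<in> obj D"
      using s_torsion_pairD(1)[OF st that] .
    have "u = \<one>\<^bsub>NExt D W Z\<^esub>" if u: "u \<in> carrier (NExt D W Z)" for u
    proof (rule exact_at_imp_one[OF conjunct1[OF conjunct2[OF exact_up[OF R W]]]])
      show "next_map D (idm D W) y \<in> hom (NExt D W Y) (NExt D W Z)"
        using N.bif_hom[OF W W r(2,3) idm_closed[OF W] r(5)] .
      show "conn_up D Z X \<delta> W u = \<one>\<^bsub>Mor D W X\<^esub>"
        using conn_up_hom[OF r(1,3,6) W] u
        by (intro s_torsion_pairD(3)[OF st \<open>W \<in> T\<close> \<open>X \<in> F\<close>]) (auto simp: hom_def)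
    qed (use u r W NExt_group s_torsion_pairD(4)[OF st \<open>W \<in> T\<close> \<open>Y \<in> F\<close>] in auto)
    then show ?thesis
      using trivial_group_iff[OF NExt_group[OF W r(3)]] by blast
  qed
  then show ?thesis
    using r(3) by (simp add: right_neg_perp_def)
qed

text \<open>Each class is the Hom-orthogonal of its partner, and passing to orthogonals reverses
  inclusions.\<close>

lemma torsion_class_mono_iff:
  assumes "s_torsion_pair D T F" and "s_torsion_pair D \<X> \<Y>"
  shows "\<X> \<subseteq> T \<longleftrightarrow> F \<subseteq> \<Y>"
proof
  assume "\<X> \<subseteq> T"
  then show "F \<subseteq> \<Y>"
    using torsion_free_class_eq_hom_perp[OF assms(1)] torsion_free_class_eq_hom_perp[OF assms(2)]
    by blast
next
  assume "F \<subseteq> \<Y>"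
  then show "\<X> \<subseteq> T"
    using torsion_class_eq_hom_perp[OF assms(1)] torsion_class_eq_hom_perp[OF assms(2)]
    by blast
qed

end

theorem proposition2p9:
  fixes D :: "('o, 'm, 'e, 'n) neg_extri"
    and T F :: "'o set"
  assumes "extriangulated_category_neg D"
    and "s_torsion_pair D T F"
  shows "(closed_under_cones D T \<and> closed_under_extensions D T \<and> closed_under_summands D T) \<and>
    (closed_under_cocones D F \<and> closed_under_extensions D F \<and> closed_under_summands D F) \<and>
    (\<forall>X x Y y Z. conflation D X x Y y Z \<longrightarrow>
      (Y \<in> T \<and> Z \<in> T \<longrightarrow> X \<in> left_neg_perp D F) \<and>
      (X \<in> F \<and> Y \<in> F \<longrightarrow> Z \<in> right_neg_perp D T)) \<and>
    (\<forall>\<X> \<Y>. s_torsion_pair D \<X> \<Y> \<longrightarrow> (\<X> \<subseteq> T \<longleftrightarrow> F \<subseteq> \<Y>))"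
proof -
  interpret extriangulated_category_neg D
    by fact
  note st = \<open>s_torsion_pair D T F\<close>
  show ?thesis
    using torsion_class_closed_under_cones[OF st] torsion_class_closed_under_extensions[OF st]
      torsion_class_closed_under_summands[OF st] torsion_free_class_closed_under_cocones[OF st]
      torsion_free_class_closed_under_extensions[OF st]
      torsion_free_class_closed_under_summands[OF st]
      cocone_in_left_neg_perp[OF st] cone_in_right_neg_perp[OF st] torsion_class_mono_iff[OF st]
    by blast
qed

end
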